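(* Let $p\ge1$, let $\bm U(\bm\xi)$ and the metrics $M_{k,\zeta}(\bm\xi)$ ($k=1,2,3$, $\zeta\in\{t,x_1,x_2,x_3\}$) be smooth functions, with subscripts $\bm i$ denoting their point values on the grid. Let the coefficients $\alpha_{p,1},\dots,\alpha_{p,p}$ satisfy $$\sum_{n=1}^pn\,\alpha_{p,n}=1,\qquad\sum_{n=1}^pn^{2s-1}\alpha_{p,n}=0,\quad s=2,\dots,p,$$ and let, for $\widetilde G\in\{\widetilde{\mathcal F}_k,\widetilde{\mathcal B}_k,\widetilde M_{k,\zeta}\}$ (two-point fluxes defined in the context), $$(\widetilde G)^{2p}_{\bm i,k,+\frac12}=\sum_{n=1}^p\alpha_{p,n}\sum_{s=0}^{n-1}\widetilde G(\bm i,k,-s\,;\ \bm i,k,-s+n).$$ Then for $k=1,2,3$ $$\frac1{\Delta\xi_k}\Big((\widetilde{\mathcal F}_k)^{2p}_{\bm i,k,+\frac12}-(\widetilde{\mathcal F}_k)^{2p}_{\bm i,k,-\frac12}\Big)=\frac{\partial\mathcal F_k}{\partial\xi_k}\Big|_{\bm i}+\mathcal O(\Delta\xi_k^{2p}).$$ Similarly, the approximations of the derivatives in the source terms and in the volume conservation law are $2p$th-order accurate: $$\frac1{\Delta\xi_k}\Big((\widetilde{\mathcal B}_k)^{2p}_{\bm i,k,+\frac12}-(\widetilde{\mathcal B}_k)^{2p}_{\bm i,k,-\frac12}\Big)=\frac{\partial\mathcal B_k}{\partial\xi_k}\Big|_{\bm i}+\mathcal O(\Delta\xi_k^{2p}),\qquad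 \frac1{\Delta\xi_k}\Big((\widetilde M_{k,t})^{2p}_{\bm i,k,+\frac12}-(\widetilde M_{k,t})^{2p}_{\bm i,k,-\frac12}\Big)=\frac{\partial M_{k,t}}{\partial\xi_k}\Big|_{\bm i}+\mathcal O(\Delta\xi_k^{2p}).$$
   Context: **Setting.** The 3D special relativistic MHD equations have conservative variables $\bm U\in\mathbb R^8$ (mass density, momentum density, energy density, magnetic field $\bm B=(B_1,B_2,B_3)$), physical fluxes $\bm F_1,\bm F_2,\bm F_3$, smooth functions of $\bm U$. Explicitly, with rest-mass density $\rho>0$, pressure $p_{\rm gas}>0$, velocity $|\bm v|<1$, $W=(1-|\bm v|^2)^{-1/2}$, $h=1+\frac{\Gamma}{\Gamma-1}\frac{p_{\rm gas}}{\rho}$ ($\Gamma\in(1,2]$), $|b|^2=|\bm B|^2/W^2+(\bm v\cdot\bm B)^2$, $p_{\rm tot}=p_{\rm gas}+\frac12|b|^2$: $\bm U=(D,\bm m,E,\bm B)^{\mathrm T}$, $D=\rho W$, $\bm m=(\rho hW^2+|\bm B|^2)\bm v-(\bm v\cdot\bm B)\bm B$, $E=DhW-p_{\rm tot}+|\bm B|^2$, $\bm F_k=\big(Dv_k,\ \bm mv_k-B_k(\bm B/W^2+(\bm v\cdot\bm B)\bm v)+p_{\rm tot}\bm e_k,\ m_k,\ v_k\bm B-B_k\bm v\big)^{\mathrm T}$. Under a moving coordinate map $t=\tau$, $\bm x=\bm x(\tau,\bm\xi)$ with Jacobian determinant $J$, write $M_{k,\zeta}=J\,\partial\xi_k/\partial\zeta$,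 $\zeta\in\{t,x_1,x_2,x_3\}$, and $$\mathcal F_k=M_{k,t}\bm U+\sum_{j=1}^3M_{k,x_j}\bm F_j,\qquad\mathcal B_k=\sum_{j=1}^3M_{k,x_j}B_j.$$ The volume conservation law is $\partial_\tau J+\sum_k\partial_{\xi_k}M_{k,t}=0$, and the source term of the curvilinear system involves $\sum_k\partial_{\xi_k}\mathcal B_k$. **Grid notation.** Uniform grid in $\bm\xi$ with steps $\Delta\xi_k$, indices $\bm i=(i_1,i_2,i_3)$; the subscript $\bm i,k,n$ means $i_k$ is increased by $n$; the flux at $\bm i,k,-\frac12$ is that at $\bm i',k,+\frac12$ with $\bm i'=(\bm i,k,-1)$. **Two-point fluxes.** $\widetilde{\bm U}(\bm U_l,\bm U_r)$ and $\widetilde{\bm F}_j(\bm U_l,\bm U_r)$ are smooth, symmetric in their two arguments, consistent ($\widetilde{\bm U}(\bm U,\bm U)=\bm U$, $\widetilde{\bm F}_j(\bm U,\bm U)=\bm F_j(\bm U)$), and are entropy conservative: $(\bm V_r-\bm V_l)^{\mathrm T}\widetilde{\bm U}=\phi_r-\phi_l$ and $(\bm V_r-\bm V_l)^{\mathrm T}\widetilde{\bm F}_j=(\psi_j)_r-(\psi_j)_l-\frac12((B_j)_l+(B_j)_r)(\Phi_r-\Phi_l)$, where $\eta=-\frac{\rho W}{\Gamma-1}\ln(p_{\rm gas}/\rho^\Gamma)$, $\bm V=\eta'(\bm U)^{\mathrm T}$, $\Phi=\rho W(\bm v\cdot\bm B)/p_{\rm gas}$, $\phi=\bm V^{\mathrm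 T}\bm U-\eta$, $\psi_j=\bm V^{\mathrm T}\bm F_j+\Phi B_j-\eta v_j$. For grid points $l,r$, $$\widetilde{\mathcal F}_k(l;r)=\tfrac12\big((M_{k,t})_l+(M_{k,t})_r\big)\widetilde{\bm U}(\bm U_l,\bm U_r)+\sum_{j=1}^3\tfrac12\big((M_{k,x_j})_l+(M_{k,x_j})_r\big)\widetilde{\bm F}_j(\bm U_l,\bm U_r),$$ $$\widetilde{\mathcal B}_k(l;r)=\sum_{j=1}^3\tfrac14\big((M_{k,x_j})_l+(M_{k,x_j})_r\big)\big((B_j)_l+(B_j)_r\big),\qquad\widetilde M_{k,\zeta}(l;r)=\tfrac12\big((M_{k,\zeta})_l+(M_{k,\zeta})_r\big).$$ *)

theory Defs
  imports "HOL-Analysis.Analysis"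
begin

section \<open>Smooth functions\<close>

text \<open>\<^term>\<open>n\<close>-fold continuous differentiability on a set. It is used only for sets that are
  open; in finite dimension continuity of all iterated directional derivatives is
  then the usual notion.\<close>

primrec Ck_on :: "nat \<Rightarrow> 'a::real_normed_vector set \<Rightarrow> ('a \<Rightarrow> 'b::real_normed_vector) \<Rightarrow> bool" where
  "Ck_on 0 S f \<longleftrightarrow> continuous_on S f"
| "Ck_on (Suc n) S f \<longleftrightarrow>
     (\<forall>x\<in>S. f differentiable (at x)) \<and> (\<forall>v. Ck_on n S (\<lambda>x. frechet_derivative f (at x) v))"

definition smooth_on :: "'a::real_normed_vector set \<Rightarrow> ('a \<Rightarrow> 'b::real_normed_vector) \<Rightarrow> bool" where
  "smooth_on S f \<longleftrightarrow> (\<forall>n. Ck_on n S f)"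

definition partial_deriv :: "3 \<Rightarrow> (real^3 \<Rightarrow> 'b::real_normed_vector) \<Rightarrow> real^3 \<Rightarrow> 'b" where
  "partial_deriv k f x = vector_derivative (\<lambda>s. f (x + s *\<^sub>R axis k 1)) (at 0)"


section \<open>Relativistic magnetohydrodynamics\<close>

text \<open>A conservative state \<open>(D, m, E, B)\<close> and a primitive state \<open>(\<rho>, v, p, B)\<close> are both elements of
  the eight-dimensional Euclidean space \<open>\<real> \<times> \<real>\<^sup>3 \<times> \<real> \<times> \<real>\<^sup>3\<close>, whose inner product and norm are
  those of \<open>\<real>\<^sup>8\<close>. The parameter \<open>\<Gamma>\<close> is the adiabatic index.\<close>

type_synonym state = "real \<times> (real^3) \<times> real \<times> (real^3)"
type_synonym primitive = "real \<times> (real^3) \<times> real \<times> (real^3)"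

definition lorentz :: "real^3 \<Rightarrow> real" where
  "lorentz v = 1 / sqrt (1 - (norm v)\<^sup>2)"

definition enthalpy :: "real \<Rightarrow> real \<Rightarrow> real \<Rightarrow> real" where
  "enthalpy \<Gamma> \<rho> p = 1 + \<Gamma> / (\<Gamma> - 1) * (p / \<rho>)"

definition total_pressure :: "real^3 \<Rightarrow> real \<Rightarrow> real^3 \<Rightarrow> real" where
  "total_pressure v p B = p + ((norm B)\<^sup>2 / (lorentz v)\<^sup>2 + (v \<bullet> B)\<^sup>2) / 2"

definition momentum :: "real \<Rightarrow> real \<Rightarrow> real^3 \<Rightarrow> real \<Rightarrow> real^3 \<Rightarrow> real^3" where
  "momentum \<Gamma> \<rho> v p B =
     (\<rho> * enthalpy \<Gamma> \<rho> p * (lorentz v)\<^sup>2 + (norm B)\<^sup>2) *\<^sub>R v - (v \<bullet> B) *\<^sub>R B"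

definition energy :: "real \<Rightarrow> real \<Rightarrow> real^3 \<Rightarrow> real \<Rightarrow> real^3 \<Rightarrow> real" where
  "energy \<Gamma> \<rho> v p B =
     \<rho> * lorentz v * enthalpy \<Gamma> \<rho> p * lorentz v - total_pressure v p B + (norm B)\<^sup>2"

definition primitive_states :: "primitive set" where
  "primitive_states = {(\<rho>, v, p, B). \<rho> > 0 \<and> norm v < 1 \<and> p > 0}"

definition conservative :: "real \<Rightarrow> primitive \<Rightarrow> state" where
  "conservative \<Gamma> = (\<lambda>(\<rho>, v, p, B).
     (\<rho> * lorentz v, momentum \<Gamma> \<rho> v p B, energy \<Gamma> \<rho> v p B, B))"

definition admissible :: "real \<Rightarrow> state set" where
  "admissible \<Gamma> = conservative \<Gamma> ` primitive_states"

definition primitive_of :: "real \<Rightarrow> state \<Rightarrow> primitive" where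
  "primitive_of \<Gamma> = inv_into primitive_states (conservative \<Gamma>)"

definition magnetic :: "state \<Rightarrow> real^3" where
  "magnetic = (\<lambda>(D, m, E, B). B)"

definition flux :: "real \<Rightarrow> 3 \<Rightarrow> state \<Rightarrow> state" where
  "flux \<Gamma> k U = (case primitive_of \<Gamma> U of (\<rho>, v, p, B) \<Rightarrow>
     (\<rho> * lorentz v * v $ k,
      (v $ k) *\<^sub>R momentum \<Gamma> \<rho> v p B
        - (B $ k) *\<^sub>R ((1 / (lorentz v)\<^sup>2) *\<^sub>R B + (v \<bullet> B) *\<^sub>R v)
        + total_pressure v p B *\<^sub>R axis k 1,
      momentum \<Gamma> \<rho> v p B $ k,
      (v $ k) *\<^sub>R B - (B $ k) *\<^sub>R v))"


section \<open>Entropy and two-point fluxes\<close>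

definition entropy :: "real \<Rightarrow> state \<Rightarrow> real" where
  "entropy \<Gamma> U = (case primitive_of \<Gamma> U of (\<rho>, v, p, B) \<Rightarrow>
     - (\<rho> * lorentz v / (\<Gamma> - 1)) * ln (p / \<rho> powr \<Gamma>))"

definition entropy_vars :: "real \<Rightarrow> state \<Rightarrow> state" where
  "entropy_vars \<Gamma> U = (THE V. GDERIV (entropy \<Gamma>) U :> V)"

definition source_potential :: "real \<Rightarrow> state \<Rightarrow> real" where
  "source_potential \<Gamma> U = (case primitive_of \<Gamma> U of (\<rho>, v, p, B) \<Rightarrow>
     \<rho> * lorentz v * (v \<bullet> B) / p)"

definition entropy_potential :: "real \<Rightarrow> state \<Rightarrow> real" where
  "entropy_potential \<Gamma> U = entropy_vars \<Gamma> U \<bullet> U - entropy \<Gamma> U"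

definition flux_potential :: "real \<Rightarrow> 3 \<Rightarrow> state \<Rightarrow> real" where
  "flux_potential \<Gamma> j U = (case primitive_of \<Gamma> U of (\<rho>, v, p, B) \<Rightarrow>
     entropy_vars \<Gamma> U \<bullet> flux \<Gamma> j U + source_potential \<Gamma> U * B $ j - entropy \<Gamma> U * v $ j)"

definition smooth_symmetric_consistent ::
    "real \<Rightarrow> (state \<Rightarrow> state \<Rightarrow> state) \<Rightarrow> (state \<Rightarrow> state) \<Rightarrow> bool" where
  "smooth_symmetric_consistent \<Gamma> G g \<longleftrightarrow>
     smooth_on (admissible \<Gamma> \<times> admissible \<Gamma>) (\<lambda>(a, b). G a b) \<and>
     (\<forall>a\<in>admissible \<Gamma>. \<forall>b\<in>admissible \<Gamma>. G a b = G b a) \<and>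
     (\<forall>a\<in>admissible \<Gamma>. G a a = g a)"

definition entropy_conservative ::
    "real \<Rightarrow> (state \<Rightarrow> state \<Rightarrow> state) \<Rightarrow> (3 \<Rightarrow> state \<Rightarrow> state \<Rightarrow> state) \<Rightarrow> bool" where
  "entropy_conservative \<Gamma> Ut Ft \<longleftrightarrow>
     (\<forall>l\<in>admissible \<Gamma>. \<forall>r\<in>admissible \<Gamma>.
        (entropy_vars \<Gamma> r - entropy_vars \<Gamma> l) \<bullet> Ut l r
          = entropy_potential \<Gamma> r - entropy_potential \<Gamma> l \<and>
        (\<forall>j. (entropy_vars \<Gamma> r - entropy_vars \<Gamma> l) \<bullet> Ft j l r
          = flux_potential \<Gamma> j r - flux_potential \<Gamma> j l
            - (magnetic l $ j + magnetic r $ j) / 2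
              * (source_potential \<Gamma> r - source_potential \<Gamma> l)))"


section \<open>Curvilinear coordinates\<close>

text \<open>The moving map is \<open>t = \<tau>\<close>, \<open>x = X \<tau> \<xi>\<close> for \<open>\<tau> \<in> T\<close>, \<open>\<xi> \<in> \<Omega>\<close>. Because \<open>t = \<tau>\<close>, the Jacobian
  determinant of the space-time map is that of its spatial part, and the computational
  coordinate \<open>\<xi>(t, x)\<close> is \<open>inv_into \<Omega> (X t) x\<close>.\<close>

definition jac_det :: "(real \<Rightarrow> real^3 \<Rightarrow> real^3) \<Rightarrow> real \<Rightarrow> real^3 \<Rightarrow> real" where
  "jac_det X \<tau> \<xi> = det (jacobian (X \<tau>) (at \<xi>))"

definition coordinate_map :: "real set \<Rightarrow> (real^3) set \<Rightarrow> (real \<Rightarrow> real^3 \<Rightarrow> real^3) \<Rightarrow> bool" where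
  "coordinate_map T \<Omega> X \<longleftrightarrow>
     open T \<and> open \<Omega> \<and> Ck_on 1 (T \<times> \<Omega>) (\<lambda>(\<tau>, \<xi>). X \<tau> \<xi>) \<and>
     (\<forall>\<tau>\<in>T. inj_on (X \<tau>) \<Omega> \<and> (\<forall>\<xi>\<in>\<Omega>. jac_det X \<tau> \<xi> \<noteq> 0))"

datatype phys_coord = Time | Space 3

definition map_metric ::
    "(real^3) set \<Rightarrow> (real \<Rightarrow> real^3 \<Rightarrow> real^3) \<Rightarrow> real \<Rightarrow> 3 \<Rightarrow> phys_coord \<Rightarrow> real^3 \<Rightarrow> real" where
  "map_metric \<Omega> X \<tau> k \<zeta> \<xi> = jac_det X \<tau> \<xi> *
     (case \<zeta> of
        Time \<Rightarrow> vector_derivative (\<lambda>t. inv_into \<Omega> (X t) (X \<tau> \<xi>) $ k) (at \<tau>)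
      | Space j \<Rightarrow> partial_deriv j (\<lambda>x. inv_into \<Omega> (X \<tau>) x $ k) (X \<tau> \<xi>))"

text \<open>In the following \<open>M k \<zeta>\<close> is a family of metric functions and \<open>U\<close> the solution, both as functions
  of \<open>\<xi>\<close> at a fixed time.\<close>

definition curv_flux ::
    "real \<Rightarrow> (3 \<Rightarrow> phys_coord \<Rightarrow> real^3 \<Rightarrow> real) \<Rightarrow> (real^3 \<Rightarrow> state) \<Rightarrow> 3 \<Rightarrow> real^3 \<Rightarrow> state" where
  "curv_flux \<Gamma> M U k \<xi> =
     M k Time \<xi> *\<^sub>R U \<xi> + (\<Sum>j\<in>UNIV. M k (Space j) \<xi> *\<^sub>R flux \<Gamma> j (U \<xi>))"

definition curv_magnetic ::
    "(3 \<Rightarrow> phys_coord \<Rightarrow> real^3 \<Rightarrow> real) \<Rightarrow> (real^3 \<Rightarrow> state) \<Rightarrow> 3 \<Rightarrow> real^3 \<Rightarrow> real" where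
  "curv_magnetic M U k \<xi> = (\<Sum>j\<in>UNIV. M k (Space j) \<xi> * magnetic (U \<xi>) $ j)"

definition metric_two_point ::
    "(3 \<Rightarrow> phys_coord \<Rightarrow> real^3 \<Rightarrow> real) \<Rightarrow> 3 \<Rightarrow> phys_coord \<Rightarrow> real^3 \<Rightarrow> real^3 \<Rightarrow> real" where
  "metric_two_point M k \<zeta> l r = (M k \<zeta> l + M k \<zeta> r) / 2"

definition flux_two_point ::
    "(state \<Rightarrow> state \<Rightarrow> state) \<Rightarrow> (3 \<Rightarrow> state \<Rightarrow> state \<Rightarrow> state) \<Rightarrow>
     (3 \<Rightarrow> phys_coord \<Rightarrow> real^3 \<Rightarrow> real) \<Rightarrow> (real^3 \<Rightarrow> state) \<Rightarrow> 3 \<Rightarrow> real^3 \<Rightarrow> real^3 \<Rightarrow> state" where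
  "flux_two_point Ut Ft M U k l r =
     ((M k Time l + M k Time r) / 2) *\<^sub>R Ut (U l) (U r)
     + (\<Sum>j\<in>UNIV. ((M k (Space j) l + M k (Space j) r) / 2) *\<^sub>R Ft j (U l) (U r))"

definition magnetic_two_point ::
    "(3 \<Rightarrow> phys_coord \<Rightarrow> real^3 \<Rightarrow> real) \<Rightarrow> (real^3 \<Rightarrow> state) \<Rightarrow> 3 \<Rightarrow> real^3 \<Rightarrow> real^3 \<Rightarrow> real" where
  "magnetic_two_point M U k l r =
     (\<Sum>j\<in>UNIV. (M k (Space j) l + M k (Space j) r) * (magnetic (U l) $ j + magnetic (U r) $ j) / 4)"


section \<open>Grid and high-order fluxes\<close>

definition grid_point :: "real^3 \<Rightarrow> real^3 \<Rightarrow> int^3 \<Rightarrow> real^3" where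
  "grid_point \<xi>0 \<Delta> i = (\<chi> m. \<xi>0 $ m + of_int (i $ m) * \<Delta> $ m)"

definition shift :: "int^3 \<Rightarrow> 3 \<Rightarrow> int \<Rightarrow> int^3" where
  "shift i k n = i + axis k n"

text \<open>The flux at \<open>(i, k, +1/2)\<close>; the one at \<open>(i, k, -1/2)\<close> is obtained at \<open>shift i k (-1)\<close>.\<close>

definition high_order_flux ::
    "nat \<Rightarrow> (nat \<Rightarrow> real) \<Rightarrow> (int^3 \<Rightarrow> int^3 \<Rightarrow> 'a::real_vector) \<Rightarrow> int^3 \<Rightarrow> 3 \<Rightarrow> 'a" where
  "high_order_flux p \<alpha> G i k =
     (\<Sum>n=1..p. \<alpha> n *\<^sub>R (\<Sum>s=0..n-1. G (shift i k (- int s)) (shift i k (- int s + int n))))"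

definition flux_difference ::
    "nat \<Rightarrow> (nat \<Rightarrow> real) \<Rightarrow> (real^3 \<Rightarrow> real^3 \<Rightarrow> 'a::real_vector) \<Rightarrow> 3 \<Rightarrow>
     real^3 \<Rightarrow> real^3 \<Rightarrow> int^3 \<Rightarrow> 'a" where
  "flux_difference p \<alpha> G k \<xi>0 \<Delta> i =
     (let Gh = (\<lambda>l r. G (grid_point \<xi>0 \<Delta> l) (grid_point \<xi>0 \<Delta> r))
      in (1 / \<Delta> $ k) *\<^sub>R (high_order_flux p \<alpha> Gh i k - high_order_flux p \<alpha> Gh (shift i k (-1)) k))"

text \<open>\<open>err \<xi>0 \<Delta> i\<close> is \<open>O(\<Delta>\<^sub>k ^ q)\<close>, where \<open>err\<close> depends on the grid (origin \<open>\<xi>0\<close>, steps \<open>\<Delta>\<close>) and on a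
  grid index \<open>i\<close>. The constants do not depend on the grid or the index as long as the grid
  point stays in a given compact subset of the open domain \<open>\<Omega>\<close>; a singleton gives the
  statement at one fixed point. The bound \<open>\<delta>\<close> keeps the stencil inside \<open>\<Omega>\<close>.\<close>

definition grid_bigo ::
    "(real^3) set \<Rightarrow> 3 \<Rightarrow> nat \<Rightarrow> (real^3 \<Rightarrow> real^3 \<Rightarrow> int^3 \<Rightarrow> 'a::real_normed_vector) \<Rightarrow> bool" where
  "grid_bigo \<Omega> k q err \<longleftrightarrow>
     (\<forall>K. compact K \<and> K \<subseteq> \<Omega> \<longrightarrow>
        (\<exists>C \<delta>. \<delta> > 0 \<and>
           (\<forall>\<xi>0 \<Delta> i. (\<forall>m. \<Delta> $ m > 0) \<and> \<Delta> $ k < \<delta> \<and> grid_point \<xi>0 \<Delta> i \<in> K \<longrightarrow>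
              norm (err \<xi>0 \<Delta> i) \<le> C * \<Delta> $ k ^ q)))"

end

theory Submission
  imports Defs
begin

text \<open>The sum over \<open>s\<close> telescopes, so for a symmetric two-point flux \<open>G\<close> the flux difference at a grid
  point \<open>x\<close> equals \<open>\<Sum>n. \<alpha> n * (G x (x + n h e) - G x (x - n h e)) / h\<close>, where \<open>h\<close> is the step and \<open>e\<close> the
  unit vector in direction \<open>k\<close>. In its Taylor expansion in \<open>h\<close> the even powers cancel, and the
  conditions on \<open>\<alpha>\<close> remove the odd ones up to order \<open>2 * p - 1\<close> except the first. The remaining term is
  twice the derivative of \<open>G\<close> at \<open>(x, x)\<close> in the second argument, which by symmetry is the derivative
  of the consistent flux \<open>\<lambda>y. G y y\<close>.\<close>

section \<open>Calculus of smooth functions\<close>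

lemma Ck_on_imp_continuous_on: "Ck_on n S f \<Longrightarrow> continuous_on S f"
  by (cases n) (auto intro!: continuous_at_imp_continuous_on differentiable_imp_continuous_within)

lemma Ck_on_Suc_imp: "Ck_on (Suc n) S f \<Longrightarrow> Ck_on n S f"
proof (induction n arbitrary: f)
  case 0
  then show ?case using Ck_on_imp_continuous_on[of "Suc 0" S f] by simp
qed auto

lemma Ck_on_Suc_has_derivative:
  "Ck_on (Suc n) S f \<Longrightarrow> x \<in> S \<Longrightarrow> (f has_derivative frechet_derivative f (at x)) (at x)"
  by (rule frechet_derivative_works[THEN iffD1]) simp

text \<open>A derivative at a point depends on the values in a neighbourhood of it; openness of
  \<open>S\<close> is what lets agreement on \<open>S\<close> pass to all iterated
  derivatives.\<close>

lemma Ck_on_cong: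
  assumes "open S" "Ck_on n S f" "\<And>x. x \<in> S \<Longrightarrow> f x = g x"
  shows "Ck_on n S g"
  using assms(2,3)
proof (induction n arbitrary: f g)
  case 0
  then show ?case by (simp cong: continuous_on_cong)
next
  case (Suc n)
  have D: "(g has_derivative frechet_derivative f (at x)) (at x)" if "x \<in> S" for x
    using Ck_on_Suc_has_derivative[OF Suc.prems(1) that] assms(1) that Suc.prems(2)
    by (rule has_derivative_transform_within_open)
  then have "frechet_derivative f (at x) v = frechet_derivative g (at x) v" if "x \<in> S" for x v
    using frechet_derivative_at[OF D[OF that]] by simp
  then have "Ck_on n S (\<lambda>x. frechet_derivative g (at x) v)" for v
    using Suc.prems(1) by (intro Suc.IH[where f = "\<lambda>x. frechet_derivative f (at x) v"
          and g = "\<lambda>x. frechet_derivative g (at x) v"]) simp_all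
  moreover have "g differentiable (at x)" if "x \<in> S" for x
    using D[OF that] by (rule differentiableI)
  ultimately show ?case by simp
qed

text \<open>Uniqueness of the derivative lets an explicit formula \<open>f'\<close> stand in for the
  choice operator \<open>frechet_derivative\<close> in the recursion. The closure rules based on a
  differentiation formula all go through this rule.\<close>

lemma Ck_on_SucI:
  assumes "open S" "\<And>x. x \<in> S \<Longrightarrow> (f has_derivative f' x) (at x)"
    and "\<And>v. Ck_on n S (\<lambda>x. f' x v)"
  shows "Ck_on (Suc n) S f"
proof -
  have "Ck_on n S (\<lambda>x. frechet_derivative f (at x) v)" for v
    by (rule Ck_on_cong[OF assms(1) assms(3)[of v]])
      (simp add: frechet_derivative_at[OF assms(2), symmetric])
  moreover have "f differentiable (at x)" if "x \<in> S" for x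
    using assms(2)[OF that] by (rule differentiableI)
  ultimately show ?thesis by simp
qed

lemma Ck_on_const: "open S \<Longrightarrow> Ck_on n S (\<lambda>_. c)"
proof (induction n arbitrary: c)
  case (Suc n)
  then show ?case by (intro Ck_on_SucI[where f' = "\<lambda>_ _. 0"]) simp_all
qed simp

lemma Ck_on_bounded_linear:
  assumes "open S" "bounded_linear f"
  shows "Ck_on n S f"
proof (cases n)
  case 0
  then show ?thesis using assms by (simp add: linear_continuous_on)
next
  case (Suc m)
  then show ?thesis
    unfolding Suc using assms
    by (intro Ck_on_SucI[where f' = "\<lambda>_. f"] bounded_linear_imp_has_derivative Ck_on_const)
qed

lemma Ck_on_linear_image:
  assumes "open S" "bounded_linear L" "Ck_on n S f"
  shows "Ck_on n S (\<lambda>x. L (f x))"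
  using assms(3)
proof (induction n arbitrary: f)
  case 0
  then show ?case by (simp add: bounded_linear.continuous_on[OF assms(2)])
next
  case (Suc n)
  then show ?case
    by (intro Ck_on_SucI[OF assms(1) bounded_linear.has_derivative[OF assms(2)
            Ck_on_Suc_has_derivative]] Suc.IH) auto
qed

lemma Ck_on_add:
  assumes "open S" "Ck_on n S f" "Ck_on n S g"
  shows "Ck_on n S (\<lambda>x. f x + g x)"
  using assms(2,3)
proof (induction n arbitrary: f g)
  case 0
  then show ?case by (simp add: continuous_on_add)
next
  case (Suc n)
  then show ?case
    by (intro Ck_on_SucI[OF assms(1) has_derivative_add[OF
            Ck_on_Suc_has_derivative Ck_on_Suc_has_derivative]] Suc.IH) auto
qed

lemma Ck_on_sum:
  "open S \<Longrightarrow> (\<And>i. i \<in> I \<Longrightarrow> Ck_on n S (f i)) \<Longrightarrow> Ck_on n S (\<lambda>x. \<Sum>i\<in>I. f i x)"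
  by (induction I rule: infinite_finite_induct) (auto intro: Ck_on_const Ck_on_add)

text \<open>By the product rule the derivative is a sum of two terms of the same bilinear shape, so
  the induction hypothesis applies to each once the undifferentiated factor is lowered from class
  \<open>Suc n\<close> to class \<open>n\<close>.\<close>

lemma Ck_on_bilinear:
  assumes "open S" "bounded_bilinear B" "Ck_on n S f" "Ck_on n S g"
  shows "Ck_on n S (\<lambda>x. B (f x) (g x))"
  using assms(3,4)
proof (induction n arbitrary: f g)
  case 0
  then show ?case by (simp add: bounded_bilinear.continuous_on[OF assms(2)])
next
  case (Suc n)
  then show ?case
    by (intro Ck_on_SucI[OF assms(1) bounded_bilinear.FDERIV[OF assms(2)
            Ck_on_Suc_has_derivative Ck_on_Suc_has_derivative]] Ck_on_add[OF assms(1)] Suc.IH)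
      (auto intro: Ck_on_Suc_imp)
qed

lemma Ck_on_Pair:
  assumes "open S" "Ck_on n S f" "Ck_on n S g"
  shows "Ck_on n S (\<lambda>x. (f x, g x))"
proof -
  \<comment> \<open>A pair is the sum of the images of its components under the two linear
    embeddings.\<close>
  have "bounded_linear (\<lambda>y. (y, 0))" "bounded_linear (\<lambda>y. (0, y))"
    by (intro bounded_linear_Pair bounded_linear_ident bounded_linear_zero)+
  then have "Ck_on n S (\<lambda>x. (f x, 0) + (0, g x))"
    by (intro Ck_on_add assms(1) Ck_on_linear_image[OF assms(1) _ assms(2)]
        Ck_on_linear_image[OF assms(1) _ assms(3)])
  then show ?thesis by simp
qed

text \<open>The expansion in \<open>Basis\<close> is needed because \<^const>\<open>Ck_on\<close> controls the derivative of \<open>g\<close> only in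
  fixed directions. The set \<open>T\<close> need not be open, so that openness of \<^const>\<open>admissible\<close> plays no role.\<close>

lemma Ck_on_compose:
  fixes f :: "'a::real_normed_vector \<Rightarrow> 'b::euclidean_space"
  assumes "open S" "Ck_on n T g" "Ck_on n S f" "f ` S \<subseteq> T"
  shows "Ck_on n S (\<lambda>x. g (f x))"
  using assms(2,3)
proof (induction n arbitrary: g)
  case 0
  then show ?case using assms(4) continuous_on_compose2 by auto
next
  case (Suc n)
  have D: "((\<lambda>x. g (f x)) has_derivative
      (\<lambda>v. \<Sum>b\<in>Basis. (frechet_derivative f (at x) v \<bullet> b) *\<^sub>R frechet_derivative g (at (f x)) b)) (at x)"
    if "x \<in> S" for x
  proof -
    have g': "(g has_derivative frechet_derivative g (at (f x))) (at (f x))"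
      using Ck_on_Suc_has_derivative[OF Suc.prems(1)] that assms(4) by auto
    then have lin: "linear (frechet_derivative g (at (f x)))"
      by (rule has_derivative_linear)
    have "(\<Sum>b\<in>Basis. (w \<bullet> b) *\<^sub>R frechet_derivative g (at (f x)) b)
        = frechet_derivative g (at (f x)) w" for w
      by (simp add: linear_scale[OF lin, symmetric] linear_sum[OF lin, symmetric]
          euclidean_representation)
    then show ?thesis
      using has_derivative_compose[OF Ck_on_Suc_has_derivative[OF Suc.prems(2) that] g']
      by simp
  qed
  have "Ck_on n S (\<lambda>x. (frechet_derivative f (at x) v \<bullet> b) *\<^sub>R frechet_derivative g (at (f x)) b)"
    for v b
    using Suc.prems
    by (intro Ck_on_bilinear[OF assms(1) bounded_bilinear_scaleR]
        Ck_on_linear_image[OF assms(1) bounded_linear_inner_left]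
        Suc.IH[where g = "\<lambda>y. frechet_derivative g (at y) b"])
      (auto intro: Ck_on_Suc_imp)
  then show ?case
    by (intro Ck_on_SucI[OF assms(1) D] Ck_on_sum[OF assms(1)])
qed

section \<open>Iterated directional derivatives and Taylor's formula along a segment\<close>

definition dir_deriv ::
    "'a::real_normed_vector \<Rightarrow> ('a \<Rightarrow> 'b::real_normed_vector) \<Rightarrow> 'a \<Rightarrow> 'b" where
  "dir_deriv v f = (\<lambda>x. frechet_derivative f (at x) v)"

lemma smooth_on_dir_deriv: "smooth_on S f \<Longrightarrow> smooth_on S (dir_deriv v f)"
  unfolding smooth_on_def dir_deriv_def by (metis Ck_on.simps(2))

lemma smooth_on_dir_deriv_iter: "smooth_on S f \<Longrightarrow> smooth_on S ((dir_deriv v ^^ n) f)"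
  by (induction n) (auto intro: smooth_on_dir_deriv)

lemma smooth_on_has_derivative:
  "smooth_on S f \<Longrightarrow> x \<in> S \<Longrightarrow> (f has_derivative frechet_derivative f (at x)) (at x)"
  unfolding smooth_on_def
  by (rule frechet_derivative_works[THEN iffD1]) (metis Ck_on.simps(2))

lemma dir_deriv_has_vector_derivative:
  assumes "smooth_on S f" "x + (s * t) *\<^sub>R v \<in> S"
  shows "((\<lambda>s. f (x + (s * t) *\<^sub>R v)) has_vector_derivative
    t *\<^sub>R dir_deriv v f (x + (s * t) *\<^sub>R v)) (at s within A)"
proof -
  have D: "(f has_derivative frechet_derivative f (at (x + (s * t) *\<^sub>R v)))
      (at (x + (s * t) *\<^sub>R v))"
    using assms by (rule smooth_on_has_derivative)
  have "((\<lambda>s. x + (s * t) *\<^sub>R v) has_vector_derivative t *\<^sub>R v) (at s within A)"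
    by (auto intro!: derivative_eq_intros simp: has_vector_derivative_def)
  from vector_derivative_diff_chain_within[OF this has_derivative_at_withinI[OF D]]
  show ?thesis
    by (simp add: o_def dir_deriv_def linear_scale[OF has_derivative_linear[OF D]])
qed

text \<open>Taylor's formula with integral remainder is applied on the unit interval to the
  restriction of \<open>f\<close> to the segment. Keeping \<open>t\<close> as a factor of the
  parameter \<open>s\<close> treats both signs of \<open>t\<close> at once.\<close>

lemma dir_deriv_Taylor:
  fixes f :: "'a::real_normed_vector \<Rightarrow> 'b::banach"
  assumes "smooth_on S f" "0 < m"
    and "\<And>s. 0 \<le> s \<Longrightarrow> s \<le> 1 \<Longrightarrow> x + (s * t) *\<^sub>R v \<in> S"
    and bound: "\<And>s. 0 \<le> s \<Longrightarrow> s \<le> 1 \<Longrightarrow> norm ((dir_deriv v ^^ m) f (x + (s * t) *\<^sub>R v)) \<le> C"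
  shows "norm (f (x + t *\<^sub>R v) - (\<Sum>j<m. (t ^ j / fact j) *\<^sub>R (dir_deriv v ^^ j) f x))
    \<le> C * \<bar>t\<bar> ^ m"
proof -
  define F where "F j s = t ^ j *\<^sub>R (dir_deriv v ^^ j) f (x + (s * t) *\<^sub>R v)" for j s
  have F': "(F j has_vector_derivative F (Suc j) s) (at s within {0..1})"
    if "j < m" "0 \<le> s" "s \<le> 1" for j s
  proof -
    have "((\<lambda>s. (dir_deriv v ^^ j) f (x + (s * t) *\<^sub>R v)) has_vector_derivative
        t *\<^sub>R dir_deriv v ((dir_deriv v ^^ j) f) (x + (s * t) *\<^sub>R v)) (at s within {0..1})"
      using that by (intro dir_deriv_has_vector_derivative[where S = S] smooth_on_dir_deriv_iter assms)
    from bounded_linear.has_vector_derivative[OF bounded_linear_scaleR_right this, of "t ^ j"]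
    show ?thesis by (simp add: F_def[abs_def] mult.commute)
  qed
  define i where "i s = ((1 - s) ^ (m - 1) / fact (m - 1)) *\<^sub>R F m s" for s
  have i: "(i has_integral F 0 1 - (\<Sum>j<m. ((1 - 0) ^ j / fact j) *\<^sub>R F j 0)) {0..1}"
    unfolding i_def by (rule Taylor_has_integral[where Df = F]) (use assms(2) F' in auto)
  have C: "0 \<le> C" using order_trans[OF norm_ge_zero bound[of 0]] by simp
  have "norm (i s) \<le> C * \<bar>t\<bar> ^ m" if "s \<in> {0..1}" for s
  proof -
    \<comment> \<open>The crude bound 1 on the kernel gives up the factor \<open>1 / fact m\<close>
      in the remainder, which does not affect the order.\<close>
    have "\<bar>(1 - s) ^ (m - 1) / fact (m - 1)\<bar> \<le> 1"
      using that order_trans[OF power_le_one fact_ge_1, of "1 - s" "m - 1" "m - 1"] by simp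
    moreover have "norm (F m s) \<le> \<bar>t\<bar> ^ m * C"
      using bound[of s] that by (simp add: F_def power_abs mult_left_mono)
    ultimately have "norm (i s) \<le> 1 * (\<bar>t\<bar> ^ m * C)"
      unfolding i_def norm_scaleR by (intro mult_mono) auto
    then show ?thesis by (simp add: mult.commute)
  qed
  from has_integral_bound_real[OF _ finite.emptyI i this] C
  show ?thesis by (simp add: F_def)
qed

section \<open>Order of accuracy\<close>

lemma grid_point_shift:
  "grid_point \<xi>0 \<Delta> (shift i k n) = grid_point \<xi>0 \<Delta> i + (of_int n * \<Delta> $ k) *\<^sub>R axis k 1"
  by (simp add: vec_eq_iff grid_point_def shift_def axis_def distrib_right)

lemma shift_shift: "shift (shift i k m) k n = shift i k (m + n)"
  by (simp add: vec_eq_iff shift_def axis_def)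

text \<open>Moving the base index back by one turns the summand for \<open>s\<close> into the one
  for \<open>Suc s\<close>, so for each \<open>n\<close> only the terms \<open>s = 0\<close> and
  \<open>s = n\<close> survive.\<close>

lemma high_order_flux_telescope:
  "high_order_flux p \<alpha> G i k - high_order_flux p \<alpha> G (shift i k (-1)) k
    = (\<Sum>n=1..p. \<alpha> n *\<^sub>R (G i (shift i k (int n)) - G (shift i k (- int n)) i))"
proof -
  have "(\<Sum>s=0..n-1. G (shift i k (- int s)) (shift i k (- int s + int n)))
      - (\<Sum>s=0..n-1. G (shift (shift i k (-1)) k (- int s)) (shift (shift i k (-1)) k (- int s + int n)))
      = G i (shift i k (int n)) - G (shift i k (- int n)) i" if "n \<in> {1..p}" for n
  proof -
    define a where "a s = G (shift i k (- int s)) (shift i k (- int s + int n))" for s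
    \<comment> \<open>This needs \<open>n \<ge> 1\<close>: at \<open>n = 0\<close> truncated
      subtraction would leave the index 0 on the left.\<close>
    have "{0..n-1} = {..<n}" using that by auto
    moreover have "shift (shift i k (-1)) k (- int s) = shift i k (- int (Suc s))"
      "shift (shift i k (-1)) k (- int s + int n) = shift i k (- int (Suc s) + int n)" for s
      by (simp_all add: shift_shift algebra_simps)
    moreover have "shift i k 0 = i" by (simp add: shift_def vec_eq_iff axis_def)
    ultimately show ?thesis
      using sum_lessThan_telescope'[of a n] by (simp add: a_def sum_subtractf)
  qed
  then show ?thesis
    unfolding high_order_flux_def
    by (simp only: sum_subtractf[symmetric] scaleR_diff_right[symmetric] cong: sum.cong)
qed

lemma flux_difference_eq:
  fixes G :: "real^3 \<Rightarrow> real^3 \<Rightarrow> 'a::real_vector" and \<xi>0 \<Delta> :: "real^3" and i :: "int^3" and k :: 3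
  defines "x \<equiv> grid_point \<xi>0 \<Delta> i"
  shows "flux_difference p \<alpha> G k \<xi>0 \<Delta> i = (1 / \<Delta> $ k) *\<^sub>R (\<Sum>n=1..p. \<alpha> n *\<^sub>R
    (G x (x + (real n * \<Delta> $ k) *\<^sub>R axis k 1) - G (x + (- real n * \<Delta> $ k) *\<^sub>R axis k 1) x))"
  by (simp add: flux_difference_def high_order_flux_telescope grid_point_shift x_def)

text \<open>These sums are the coefficients that multiply the powers of the step in the symmetric
  differences. The range of \<open>j\<close> is that of a Taylor polynomial of degree
  \<open>2 * p\<close>, whose top term is even and cancels without any condition on the
  coefficients.\<close>

lemma odd_moments:
  fixes \<alpha> :: "nat \<Rightarrow> real"
  assumes "(\<Sum>n=1..p. real n * \<alpha> n) = 1"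
    and "\<And>s. s \<in> {2..p} \<Longrightarrow> (\<Sum>n=1..p. real n ^ (2 * s - 1) * \<alpha> n) = 0"
    and "j \<le> 2 * p"
  shows "(\<Sum>n=1..p. \<alpha> n * (real n ^ j - (- real n) ^ j)) = (if j = 1 then 2 else 0)"
proof (cases "even j")
  case False
  then obtain s where s: "j = 2 * s + 1" by (auto elim: oddE)
  have "(\<Sum>n=1..p. \<alpha> n * (real n ^ j - (- real n) ^ j)) = 2 * (\<Sum>n=1..p. real n ^ j * \<alpha> n)"
    using False by (simp add: power_minus_odd sum_distrib_left mult_ac)
  \<comment> \<open>The exponent \<open>2 * s + 1\<close> is the one in the moment condition at
    \<open>Suc s\<close>, and an odd \<open>j \<le> 2 * p\<close> forces
    \<open>Suc s \<le> p\<close>. The case \<open>s = 0\<close> is the normalisation.\<close>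
  moreover have "(\<Sum>n=1..p. real n ^ j * \<alpha> n) = (if j = 1 then 1 else 0)"
    using assms(1) assms(2)[of "Suc s"] assms(3) s by auto
  ultimately show ?thesis by simp
qed auto

text \<open>Symmetry makes the function invariant under \<open>prod.swap\<close> near
  \<open>(x, x)\<close>, so its derivative there agrees on \<open>(e, 0)\<close> and
  \<open>(0, e)\<close>. The chain rule along the diagonal adds these two equal
  contributions.\<close>

lemma partial_deriv_diagonal:
  fixes H :: "real^3 \<Rightarrow> real^3 \<Rightarrow> 'b::real_normed_vector"
  assumes "open \<Omega>" "smooth_on (\<Omega> \<times> \<Omega>) (\<lambda>(l, r). H l r)"
    and sym: "\<And>l r. l \<in> \<Omega> \<Longrightarrow> r \<in> \<Omega> \<Longrightarrow> H l r = H r l"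
    and diag: "\<And>x. x \<in> \<Omega> \<Longrightarrow> H x x = f x"
    and x: "x \<in> \<Omega>"
  shows "partial_deriv k f x = 2 *\<^sub>R dir_deriv (0, axis k 1) (\<lambda>(l, r). H l r) (x, x)"
proof -
  let ?h = "\<lambda>(l, r). H l r" and ?e = "axis k 1 :: real^3"
  define D where "D = frechet_derivative ?h (at (x, x))"
  have D: "(?h has_derivative D) (at (x, x))"
    unfolding D_def using assms(2) by (rule smooth_on_has_derivative) (use x in auto)
  have "(prod.swap has_derivative prod.swap) (at (x, x))"
    unfolding prod.swap_def[abs_def]
    by (intro bounded_linear_imp_has_derivative bounded_linear_Pair bounded_linear_fst bounded_linear_snd)
  then have "((\<lambda>y. ?h (prod.swap y)) has_derivative (\<lambda>v. D (prod.swap v))) (at (x, x))"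
    by (rule has_derivative_compose) (use D in simp)
  then have "(?h has_derivative (\<lambda>v. D (prod.swap v))) (at (x, x))"
    by (rule has_derivative_transform_within_open[where s = "\<Omega> \<times> \<Omega>"])
      (use assms(1) x sym in \<open>auto intro: open_Times\<close>)
  from has_derivative_unique[OF D this] have "D (?e, 0) = D (prod.swap (?e, 0))"
    by (rule fun_cong)
  then have De: "D (?e, ?e) = 2 *\<^sub>R D (0, ?e)"
    using linear_add[OF has_derivative_linear[OF D], of "(?e, 0)" "(0, ?e)"]
    by (simp add: scaleR_2)
  have "((\<lambda>s. (x + s *\<^sub>R ?e, x + s *\<^sub>R ?e)) has_vector_derivative (?e, ?e)) (at 0)"
    by (auto intro!: derivative_eq_intros simp: has_vector_derivative_def)
  from vector_derivative_diff_chain_within[OF this has_derivative_at_withinI, of ?h D] D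
  have "((\<lambda>s. H (x + s *\<^sub>R ?e) (x + s *\<^sub>R ?e)) has_vector_derivative D (?e, ?e)) (at 0)"
    by (simp add: o_def)
  \<comment> \<open>\<open>f\<close> is known to be the diagonal of \<open>H\<close> only inside
    \<open>\<Omega>\<close>, so the derivative is transferred on an open set of parameters around
    0.\<close>
  moreover have "open ((\<lambda>s. x + s *\<^sub>R ?e) -` \<Omega>)"
    using assms(1) by (intro open_vimage continuous_intros)
  ultimately have "((\<lambda>s. f (x + s *\<^sub>R ?e)) has_vector_derivative D (?e, ?e)) (at 0)"
    by (rule has_vector_derivative_transform_within_open) (use x diag in auto)
  then show ?thesis
    unfolding partial_deriv_def dir_deriv_def D_def[symmetric] De[symmetric]
    by (rule vector_derivative_at)
qed

text \<open>An arbitrary symmetric \<open>H\<close> with diagonal \<open>f\<close> covers the flux,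
  magnetic and metric cases alike. The constants are uniform in the grid because one compact
  neighbourhood of \<open>K\<close> contains every stencil in question and bounds the remainder
  derivative.\<close>

lemma grid_bigo_flux_difference:
  fixes H :: "real^3 \<Rightarrow> real^3 \<Rightarrow> 'b::banach" and \<alpha> :: "nat \<Rightarrow> real"
  assumes "open \<Omega>" and smooth: "smooth_on (\<Omega> \<times> \<Omega>) (\<lambda>(l, r). H l r)"
    and sym: "\<And>l r. l \<in> \<Omega> \<Longrightarrow> r \<in> \<Omega> \<Longrightarrow> H l r = H r l"
    and diag: "\<And>x. x \<in> \<Omega> \<Longrightarrow> H x x = f x"
    and "p \<ge> 1"
    and "(\<Sum>n=1..p. real n * \<alpha> n) = 1"
    and "\<And>s. s \<in> {2..p} \<Longrightarrow> (\<Sum>n=1..p. real n ^ (2 * s - 1) * \<alpha> n) = 0"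
  shows "grid_bigo \<Omega> k (2 * p) (\<lambda>\<xi>0 \<Delta> i.
    flux_difference p \<alpha> H k \<xi>0 \<Delta> i - partial_deriv k f (grid_point \<xi>0 \<Delta> i))"
  unfolding grid_bigo_def
proof (intro allI impI)
  fix K assume K: "compact K \<and> K \<subseteq> \<Omega>"
  \<comment> \<open>The expansion is carried to remainder order \<open>2 * p + 1\<close> because
    division by the step costs one power.\<close>
  let ?h = "\<lambda>(l, r). H l r" and ?e = "axis k 1 :: real^3" and ?m = "2 * p + 1"
  let ?A = "\<lambda>j x. (dir_deriv (0, ?e) ^^ j) ?h (x, x)"
  obtain \<epsilon> where \<epsilon>: "\<epsilon> > 0" "\<And>y z. y \<in> K \<Longrightarrow> norm z \<le> \<epsilon> \<Longrightarrow> y + z \<in> \<Omega>"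
  \<comment> \<open>\<open>infdist\<close> to the empty set is 0 by convention, so the separation
    argument requires \<open>K\<close> to be nonempty; for empty \<open>K\<close> any radius will
    do.\<close>
  proof (cases "K = {}")
    case False
    then obtain \<epsilon> where e: "\<epsilon> > 0" "{x. infdist x K \<le> \<epsilon>} \<subseteq> \<Omega>"
      using compact_in_open_separated[of K \<Omega>] K assms(1) by auto
    have "infdist (y + z) K \<le> \<epsilon>" if "y \<in> K" "norm z \<le> \<epsilon>" for y z
      using infdist_le[OF that(1), of "y + z"] that(2) by (simp add: dist_norm)
    with e show ?thesis using that by blast
  qed (use that[of 1] in auto)
  \<comment> \<open>The closed neighbourhood of radius \<open>\<epsilon>\<close> is compact as a sum
    of two compact sets and contains the segments along which the expansion is made.\<close>
  define K' where "K' = {y + z | y z. y \<in> K \<and> z \<in> cball 0 \<epsilon>}"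
  have "compact K'" "K' \<subseteq> \<Omega>"
    using K \<epsilon>(2) compact_sums[of K "cball 0 \<epsilon>"] unfolding K'_def by auto
  moreover have "continuous_on (\<Omega> \<times> \<Omega>) ((dir_deriv (0, ?e) ^^ ?m) ?h)"
    using smooth_on_dir_deriv_iter[OF smooth] unfolding smooth_on_def by (metis Ck_on.simps(1))
  ultimately have "bounded ((dir_deriv (0, ?e) ^^ ?m) ?h ` (K' \<times> K'))"
    by (intro compact_imp_bounded compact_continuous_image compact_Times)
      (auto elim: continuous_on_subset)
  then obtain B where B: "\<And>y z. y \<in> K' \<Longrightarrow> z \<in> K' \<Longrightarrow> norm ((dir_deriv (0, ?e) ^^ ?m) ?h (y, z)) \<le> B"
    by (auto simp: bounded_iff)
  define P where "P x t = (\<Sum>j<?m. (t ^ j / fact j) *\<^sub>R ?A j x)" for x t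
  have in_K': "x + t *\<^sub>R ?e \<in> K'" if "x \<in> K" "\<bar>t\<bar> \<le> \<epsilon>" for x t
    unfolding K'_def mem_Collect_eq
    by (rule exI[of _ x], rule exI[of _ "t *\<^sub>R ?e"]) (use that in simp)
  have Taylor: "norm (H x (x + t *\<^sub>R ?e) - P x t) \<le> B * \<bar>t\<bar> ^ ?m" if "x \<in> K" "\<bar>t\<bar> \<le> \<epsilon>" for x t
  proof -
    have "\<bar>s * t\<bar> \<le> \<epsilon>" if "0 \<le> s" "s \<le> 1" for s
      using that \<open>\<bar>t\<bar> \<le> \<epsilon>\<close> mult_left_le_one_le[of "\<bar>t\<bar>" s] by (simp add: abs_mult)
    then have in_K'': "x \<in> K'" "x + (s * t) *\<^sub>R ?e \<in> K'" if "0 \<le> s" "s \<le> 1" for s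
      using in_K'[OF \<open>x \<in> K\<close>, of "s * t"] in_K'[OF \<open>x \<in> K\<close>, of 0] \<epsilon>(1) that by auto
    show ?thesis
      \<comment> \<open>The direction \<open>(0, ?e)\<close> moves only the second argument; the
        first stays at \<open>x\<close>, which also lies in \<open>K'\<close>.\<close>
      unfolding P_def
      using dir_deriv_Taylor[OF smooth, of ?m "(x, x)" t "(0, ?e)" B] in_K'' \<open>K' \<subseteq> \<Omega>\<close> B
      by (auto simp: subset_iff simp del: funpow.simps)
  qed
  \<comment> \<open>For each \<open>n\<close> the remainders at \<open>n * h\<close> and
    \<open>- n * h\<close> are each at most \<open>B * (n * h) ^ (2 * p + 1)\<close>, hence the
    factor 2.\<close>
  define C where "C = (\<Sum>n=1..p. \<bar>\<alpha> n\<bar> * (2 * B * real n ^ ?m))"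
  have "norm (flux_difference p \<alpha> H k \<xi>0 \<Delta> i - partial_deriv k f (grid_point \<xi>0 \<Delta> i))
      \<le> C * \<Delta> $ k ^ (2 * p)"
    \<comment> \<open>The threshold \<open>\<epsilon> / p\<close> keeps even the widest offset,
      \<open>n = p\<close>, within distance \<open>\<epsilon>\<close>.\<close>
    if \<Delta>: "\<forall>m. \<Delta> $ m > 0" "\<Delta> $ k < \<epsilon> / p" "grid_point \<xi>0 \<Delta> i \<in> K" for \<xi>0 \<Delta> i
  proof -
    define x where "x = grid_point \<xi>0 \<Delta> i"
    define h where "h = \<Delta> $ k"
    have h: "h > 0" and x: "x \<in> K" "x \<in> \<Omega>" using \<Delta> K by (auto simp: h_def x_def)
    have nh: "\<bar>real n * h\<bar> \<le> \<epsilon>" "\<bar>- real n * h\<bar> \<le> \<epsilon>" if "n \<in> {1..p}" for n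
    proof -
      have "real n * h \<le> real p * h" using that h by (intro mult_right_mono) auto
      also have "\<dots> \<le> \<epsilon>" using \<Delta>(2) assms(5) by (simp add: h_def field_simps)
      finally show "\<bar>real n * h\<bar> \<le> \<epsilon>" "\<bar>- real n * h\<bar> \<le> \<epsilon>" using h by (simp_all add: abs_mult)
    qed
    define R where "R t = H x (x + t *\<^sub>R ?e) - P x t" for t
    have "(\<Sum>n=1..p. \<alpha> n *\<^sub>R (P x (real n * h) - P x (- real n * h)))
        = (\<Sum>n=1..p. \<Sum>j<?m. (\<alpha> n * (real n ^ j - (- real n) ^ j)) *\<^sub>R (h ^ j / fact j) *\<^sub>R ?A j x)"
      by (simp only: P_def sum_subtractf[symmetric] scaleR_sum_right scaleR_diff_left[symmetric]
          scaleR_scaleR power_mult_distrib diff_divide_distrib[symmetric] times_divide_eq_right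
          left_diff_distrib[symmetric] mult.assoc)
    also have "\<dots> = (\<Sum>j<?m. (\<Sum>n=1..p. \<alpha> n * (real n ^ j - (- real n) ^ j)) *\<^sub>R (h ^ j / fact j) *\<^sub>R ?A j x)"
      by (subst sum.swap) (simp only: scaleR_sum_left)
    \<comment> \<open>Only the first-order term survives; its moment is 2 because the offsets
      \<open>n\<close> and \<open>- n\<close> contribute equally.\<close>
    also have "\<dots> = (\<Sum>j<?m. if j = 1 then (2 * h) *\<^sub>R ?A 1 x else 0)"
      by (intro sum.cong refl) (subst odd_moments[OF assms(6,7)], auto)
    also have "\<dots> = (2 * h) *\<^sub>R ?A 1 x"
      using assms(5) by (subst sum.delta) auto
    finally have P: "(\<Sum>n=1..p. \<alpha> n *\<^sub>R (P x (real n * h) - P x (- real n * h))) = (2 * h) *\<^sub>R ?A 1 x" .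
    define S where "S = (\<Sum>n=1..p. \<alpha> n *\<^sub>R (H x (x + (real n * h) *\<^sub>R ?e) - H (x + (- real n * h) *\<^sub>R ?e) x))"
    \<comment> \<open>Symmetry brings \<open>x\<close> into the first slot of the backward term too,
      so that one expansion in the second slot serves both. The neighbour lies in
      \<open>\<Omega>\<close>, where symmetry is available.\<close>
    have "S = (\<Sum>n=1..p. \<alpha> n *\<^sub>R (H x (x + (real n * h) *\<^sub>R ?e) - H x (x + (- real n * h) *\<^sub>R ?e)))"
      unfolding S_def
      using sym[OF x(2)] in_K'[OF x(1) nh(2)] \<open>K' \<subseteq> \<Omega>\<close> by (intro sum.cong refl) (metis subsetD)
    then have "S - (2 * h) *\<^sub>R ?A 1 x = (\<Sum>n=1..p. \<alpha> n *\<^sub>R (R (real n * h) - R (- real n * h)))"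
      by (simp only: P[symmetric] R_def sum_subtractf[symmetric] scaleR_diff_right[symmetric])
        (simp add: algebra_simps)
    also have "norm \<dots> \<le> (\<Sum>n=1..p. \<bar>\<alpha> n\<bar> * (2 * B * real n ^ ?m) * h ^ ?m)"
    proof (rule sum_norm_le)
      fix n assume n: "n \<in> {1..p}"
      have "norm (R (real n * h) - R (- real n * h)) \<le> B * \<bar>real n * h\<bar> ^ ?m + B * \<bar>- real n * h\<bar> ^ ?m"
        unfolding R_def
        by (rule order_trans[OF norm_triangle_ineq4
              add_mono[OF Taylor[OF x(1) nh(1)[OF n]] Taylor[OF x(1) nh(2)[OF n]]]])
      also have "\<dots> = 2 * B * real n ^ ?m * h ^ ?m"
        using h by (simp add: abs_mult power_mult_distrib)
      finally show "norm (\<alpha> n *\<^sub>R (R (real n * h) - R (- real n * h)))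
          \<le> \<bar>\<alpha> n\<bar> * (2 * B * real n ^ ?m) * h ^ ?m"
        by (simp only: norm_scaleR mult.assoc mult_left_mono[OF _ abs_ge_zero])
    qed
    also have "\<dots> = C * h ^ ?m" by (simp only: C_def sum_distrib_right)
    finally have S: "norm (S - (2 * h) *\<^sub>R ?A 1 x) \<le> C * h ^ ?m" .
    have "flux_difference p \<alpha> H k \<xi>0 \<Delta> i = (1 / h) *\<^sub>R S"
      unfolding flux_difference_eq S_def x_def h_def ..
    moreover have "partial_deriv k f x = 2 *\<^sub>R ?A 1 x"
      using partial_deriv_diagonal[OF assms(1) smooth sym diag x(2)] by simp
    ultimately have "flux_difference p \<alpha> H k \<xi>0 \<Delta> i - partial_deriv k f x
        = (1 / h) *\<^sub>R (S - (2 * h) *\<^sub>R ?A 1 x)"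
      using h by (simp add: scaleR_diff_right)
    also have "norm \<dots> = (1 / h) * norm (S - (2 * h) *\<^sub>R ?A 1 x)"
      unfolding norm_scaleR using h by simp
    also have "\<dots> \<le> (1 / h) * (C * h ^ ?m)"
      using S by (rule mult_left_mono) (use h in simp)
    also have "\<dots> = C * h ^ (2 * p)" using h by simp
    finally show ?thesis by (simp add: x_def h_def)
  qed
  moreover have "\<epsilon> / p > 0" using \<epsilon>(1) assms(5) by simp
  ultimately show "\<exists>C \<delta>. \<delta> > 0 \<and> (\<forall>\<xi>0 \<Delta> i. (\<forall>m. \<Delta> $ m > 0) \<and> \<Delta> $ k < \<delta> \<and> grid_point \<xi>0 \<Delta> i \<in> K \<longrightarrow>
      norm (flux_difference p \<alpha> H k \<xi>0 \<Delta> i - partial_deriv k f (grid_point \<xi>0 \<Delta> i))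
        \<le> C * \<Delta> $ k ^ (2 * p))"
    by blast
qed

section \<open>Smoothness of the three two-point fluxes and the final statement\<close>

lemma Ck_on_fst:
  fixes f :: "'a::euclidean_space \<Rightarrow> 'c::real_normed_vector"
  assumes "open S" "open T" "Ck_on n S f"
  shows "Ck_on n (S \<times> T) (\<lambda>x::'a \<times> 'b::euclidean_space. f (fst x))"
  using assms by (intro Ck_on_compose[OF _ assms(3)] Ck_on_bounded_linear open_Times bounded_linear_fst) auto

lemma Ck_on_snd:
  fixes f :: "'b::euclidean_space \<Rightarrow> 'c::real_normed_vector"
  assumes "open S" "open T" "Ck_on n T f"
  shows "Ck_on n (S \<times> T) (\<lambda>x::'a::euclidean_space \<times> 'b. f (snd x))"
  using assms by (intro Ck_on_compose[OF _ assms(3)] Ck_on_bounded_linear open_Times bounded_linear_snd) auto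

lemma Ck_on_two_point:
  fixes U :: "'a::euclidean_space \<Rightarrow> 'c::euclidean_space"
  assumes "open S" "Ck_on n S U" "Ck_on n (T \<times> T) (\<lambda>(a, b). G a b)" "U ` S \<subseteq> T"
  shows "Ck_on n (S \<times> S) (\<lambda>x. G (U (fst x)) (U (snd x)))"
proof -
  have "Ck_on n (S \<times> S) (\<lambda>x. (U (fst x), U (snd x)))"
    using assms by (intro Ck_on_Pair Ck_on_fst Ck_on_snd open_Times)
  moreover have "(\<lambda>x. (U (fst x), U (snd x))) ` (S \<times> S) \<subseteq> T \<times> T" using assms(4) by auto
  ultimately show ?thesis
    using Ck_on_compose[OF open_Times[OF assms(1,1)] assms(3)] by fastforce
qed

lemma bounded_linear_magnetic_nth: "bounded_linear (\<lambda>u. magnetic u $ j)"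
proof -
  have "(\<lambda>u. magnetic u $ j) = (\<lambda>u. snd (snd (snd u)) $ j)" by (auto simp: magnetic_def)
  then show ?thesis
    by (simp only:) (intro bounded_linear_compose[OF bounded_linear_vec_nth]
        bounded_linear_compose[OF bounded_linear_snd] bounded_linear_snd)
qed

theorem proposition3p1:
  fixes \<Gamma> \<tau> :: real
    and T :: "real set"
    and \<Omega> :: "(real^3) set"
    and X :: "real \<Rightarrow> real^3 \<Rightarrow> real^3"
    and U :: "real^3 \<Rightarrow> state"
    and M :: "3 \<Rightarrow> phys_coord \<Rightarrow> real^3 \<Rightarrow> real"
    and Ut :: "state \<Rightarrow> state \<Rightarrow> state"
    and Ft :: "3 \<Rightarrow> state \<Rightarrow> state \<Rightarrow> state"
    and p :: nat
    and \<alpha> :: "nat \<Rightarrow> real"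
    and k :: 3
  assumes "1 < \<Gamma>" and "\<Gamma> \<le> 2"
    and "coordinate_map T \<Omega> X" and "\<tau> \<in> T"
    and M_def: "M = map_metric \<Omega> X \<tau>"
    and "\<And>k \<zeta>. smooth_on \<Omega> (M k \<zeta>)"
    and "smooth_on \<Omega> U" and "\<And>\<xi>. \<xi> \<in> \<Omega> \<Longrightarrow> U \<xi> \<in> admissible \<Gamma>"
    and "smooth_symmetric_consistent \<Gamma> Ut (\<lambda>u. u)"
    and "\<And>j. smooth_symmetric_consistent \<Gamma> (Ft j) (flux \<Gamma> j)"
    and "entropy_conservative \<Gamma> Ut Ft"
    and "p \<ge> 1"
    and "(\<Sum>n=1..p. real n * \<alpha> n) = 1"
    and "\<And>s. s \<in> {2..p} \<Longrightarrow> (\<Sum>n=1..p. real n ^ (2 * s - 1) * \<alpha> n) = 0"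
  shows "grid_bigo \<Omega> k (2 * p) (\<lambda>\<xi>0 \<Delta> i.
            flux_difference p \<alpha> (flux_two_point Ut Ft M U k) k \<xi>0 \<Delta> i
            - partial_deriv k (curv_flux \<Gamma> M U k) (grid_point \<xi>0 \<Delta> i))
       \<and> grid_bigo \<Omega> k (2 * p) (\<lambda>\<xi>0 \<Delta> i.
            flux_difference p \<alpha> (magnetic_two_point M U k) k \<xi>0 \<Delta> i
            - partial_deriv k (curv_magnetic M U k) (grid_point \<xi>0 \<Delta> i))
       \<and> grid_bigo \<Omega> k (2 * p) (\<lambda>\<xi>0 \<Delta> i.
            flux_difference p \<alpha> (metric_two_point M k Time) k \<xi>0 \<Delta> i
            - partial_deriv k (M k Time) (grid_point \<xi>0 \<Delta> i))"
proof -
  have \<Omega>: "open \<Omega>" using assms(3) by (simp add: coordinate_map_def)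
  then have \<Omega>2: "open (\<Omega> \<times> \<Omega>)" by (intro open_Times)
  \<comment> \<open>With the moment conditions discharged, each flux leaves three obligations: joint
    smoothness, symmetry, and consistency on the diagonal.\<close>
  note order = grid_bigo_flux_difference[OF \<Omega> _ _ _ assms(12-14)]
  have mean: "Ck_on n (\<Omega> \<times> \<Omega>) (\<lambda>x. (g (fst x) + g (snd x)) / 2)"
    if "Ck_on n \<Omega> g" for n and g :: "real^3 \<Rightarrow> real"
    using that by (intro Ck_on_linear_image[OF \<Omega>2 bounded_linear_divide] Ck_on_add \<Omega>2 Ck_on_fst Ck_on_snd \<Omega>)
  have M: "Ck_on n \<Omega> (M k \<zeta>)" for n \<zeta> using assms(6) by (simp add: smooth_on_def)
  have U: "Ck_on n \<Omega> U" for n using assms(7) by (simp add: smooth_on_def)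
  have adm: "U ` \<Omega> \<subseteq> admissible \<Gamma>" using assms(8) by auto
  have two_point: "Ck_on n (\<Omega> \<times> \<Omega>) (\<lambda>x. G (U (fst x)) (U (snd x)))"
    if "smooth_symmetric_consistent \<Gamma> G g" for G g n
    using that by (intro Ck_on_two_point[OF \<Omega> U _ adm])
      (simp add: smooth_symmetric_consistent_def smooth_on_def)
  have "smooth_on (\<Omega> \<times> \<Omega>) (\<lambda>(l, r). flux_two_point Ut Ft M U k l r)"
    unfolding smooth_on_def flux_two_point_def case_prod_unfold
    by (intro allI Ck_on_add Ck_on_sum Ck_on_bilinear[OF \<Omega>2 bounded_bilinear_scaleR]
        \<Omega>2 mean M two_point[OF assms(9)] two_point[OF assms(10)])
  moreover have "flux_two_point Ut Ft M U k l r = flux_two_point Ut Ft M U k r l"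
    if "l \<in> \<Omega>" "r \<in> \<Omega>" for l r
    using assms(8)[OF that(1)] assms(8)[OF that(2)] assms(9,10)
    by (simp add: flux_two_point_def smooth_symmetric_consistent_def add.commute)
  moreover have "flux_two_point Ut Ft M U k x x = curv_flux \<Gamma> M U k x" if "x \<in> \<Omega>" for x
    using assms(8)[OF that] assms(9,10)
    by (simp add: flux_two_point_def curv_flux_def smooth_symmetric_consistent_def)
  ultimately have 1: "grid_bigo \<Omega> k (2 * p) (\<lambda>\<xi>0 \<Delta> i.
            flux_difference p \<alpha> (flux_two_point Ut Ft M U k) k \<xi>0 \<Delta> i
            - partial_deriv k (curv_flux \<Gamma> M U k) (grid_point \<xi>0 \<Delta> i))"
    by (rule order)
  \<comment> \<open>Splitting the factor 1/4 between the two sums exhibits each term as a product of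
    two means, to which the bilinear rule applies.\<close>
  have "magnetic_two_point M U k l r = (\<Sum>j\<in>UNIV. ((M k (Space j) l + M k (Space j) r) / 2)
      * ((magnetic (U l) $ j + magnetic (U r) $ j) / 2))" for l r
    by (simp add: magnetic_two_point_def)
  then have "smooth_on (\<Omega> \<times> \<Omega>) (\<lambda>(l, r). magnetic_two_point M U k l r)"
    unfolding smooth_on_def case_prod_unfold
    by (simp only:) (intro allI Ck_on_sum Ck_on_bilinear[OF \<Omega>2 bounded_bilinear_mult]
        \<Omega>2 mean M Ck_on_linear_image[OF \<Omega> bounded_linear_magnetic_nth] U)
  then have 2: "grid_bigo \<Omega> k (2 * p) (\<lambda>\<xi>0 \<Delta> i.
            flux_difference p \<alpha> (magnetic_two_point M U k) k \<xi>0 \<Delta> i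
            - partial_deriv k (curv_magnetic M U k) (grid_point \<xi>0 \<Delta> i))"
    by (rule order) (simp_all add: magnetic_two_point_def curv_magnetic_def add.commute)
  have "smooth_on (\<Omega> \<times> \<Omega>) (\<lambda>(l, r). metric_two_point M k Time l r)"
    unfolding smooth_on_def metric_two_point_def case_prod_unfold by (intro allI mean M)
  then have "grid_bigo \<Omega> k (2 * p) (\<lambda>\<xi>0 \<Delta> i.
            flux_difference p \<alpha> (metric_two_point M k Time) k \<xi>0 \<Delta> i
            - partial_deriv k (M k Time) (grid_point \<xi>0 \<Delta> i))"
    by (rule order) (simp_all add: metric_two_point_def add.commute)
  with 1 2 show ?thesis by blast
qed

end
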